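(* Let $\Phi:\mathbb{R}^N\to(-\infty,+\infty]$ be a proper and lower semicontinuous function which is bounded from below. Let $\mathcal{A}$ be a generic algorithm (a set-valued map on $\mathbb{R}^N$) which generates a bounded sequence $\{z^{(k)}\}$ by $z^{(0)}\in\mathbb{R}^N$, $z^{(k+1)}\in\mathcal{A}(z^{(k)})$, $k=0,1,\dots$. Assume that there exist positive constants $\rho_1,\rho_2,\rho_3$ and a non-negative sequence $\{\zeta_k\}_{k\in\mathbb{N}}$ such that the following conditions are satisfied. (B1) Sufficient decrease property: for all $k=0,1,\dots$, $$\rho_1\|z^{(k)}-z^{(k+1)}\|^2\le\rho_2\zeta_k^2\le\Phi(z^{(k)})-\Phi(z^{(k+1)}).$$ (B2) Boundedness of subgradient: there are $w^{(k)}\in\partial\Phi(z^{(k)})$ such that $\|w^{(k+1)}\|\le\rho_3\zeta_k$ for all $k=0,1,\dots$. (B3) KL property: $\Phi$ is a KL function. (B4) A continuity condition: if a subsequence $\{z^{(k_n)}\}$ converges to $\bar z$, then $\Phi(z^{(k_n)})\to\Phi(\bar z)$ as $n\to\infty$. Then $\sum_{k=1}^\infty\zeta_k<\infty$ and $\{z^{(k)}\}$ converges to a critical point of $\Phi$.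
   Context: For a proper lower semicontinuous $g$ and $x\in\operatorname{dom}g$, the Fréchet subdifferential $\hat\partial g(x)$ is the set of $v$ with $\liminf_{y\ne x,y\to x}\frac{1}{\|y-x\|}(g(y)-g(x)-\langle v,y-x\rangle)\ge0$ ($\hat\partial g(x)=\emptyset$ if $x\notin\operatorname{dom}g$), and the limiting subdifferential $\partial g(x)$ is the set of $v$ for which there exist $x^{(k)}\to x$ with $g(x^{(k)})\to g(x)$ and $v^{(k)}\in\hat\partial g(x^{(k)})$ with $v^{(k)}\to v$. A critical point of $\Phi$ is a point $\bar z\in\operatorname{dom}\Phi$ with $0\in\partial\Phi(\bar z)$. KL property: a function $\phi$ has the KL property at $\bar x\in\operatorname{dom}\partial\phi$ if there exist $\eta\in(0,+\infty]$, a neighborhood $U$ of $\bar x$ and a concave function $\xi:[0,\eta)\to\mathbb{R}_+$ that is continuously differentiable on $(0,\eta)$, continuous at $0$, with $\xi(0)=0$ and $\xi'(t)>0$ for all $t\in(0,\eta)$, such that for all $x\in U$ with $\phi(\bar x)<\phi(x)<\phi(\bar x)+\eta$ one has $\xi'(\phi(x)-\phi(\bar x))\operatorname{dist}(0,\partial\phi(x))\ge1$, where $\operatorname{dist}(0,\partial\phi(x))=\min\{\|y\|:y\in\partial\phi(x)\}$ (equal to $+\infty$ if $\partial\phi(x)=\emptyset$). $\phi$ is a KL function if it has the KL property at each point of $\operatorname{dom}\partial\phi$. *)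

theory Defs
  imports "HOL-Analysis.Analysis"
begin

definition eff_dom :: "('a \<Rightarrow> ereal) \<Rightarrow> 'a set" where
  "eff_dom g = {x. g x < \<infinity>}"

definition proper :: "('a \<Rightarrow> ereal) \<Rightarrow> bool" where
  "proper g \<longleftrightarrow> (\<forall>x. g x \<noteq> -\<infinity>) \<and> eff_dom g \<noteq> {}"

definition lsc :: "('a::topological_space \<Rightarrow> ereal) \<Rightarrow> bool" where
  "lsc g \<longleftrightarrow> (\<forall>x. g x \<le> Liminf (at x) g)"

definition bounded_from_below :: "('a \<Rightarrow> ereal) \<Rightarrow> bool" where
  "bounded_from_below g \<longleftrightarrow> (\<exists>m::real. \<forall>x. ereal m \<le> g x)"

definition frechet_subdiff :: "('a::real_inner \<Rightarrow> ereal) \<Rightarrow> 'a \<Rightarrow> 'a set" where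
  "frechet_subdiff g x =
     {v. x \<in> eff_dom g \<and>
         0 \<le> Liminf (at x) (\<lambda>y. ereal (1 / norm (y - x)) * (g y - g x - ereal (v \<bullet> (y - x))))}"

text \<open>The limiting subdifferential is empty outside the effective domain. This has to be said
  explicitly: \<open>g (u k) \<longlonglongrightarrow> g x = \<infinity>\<close> can hold along points \<open>u k\<close> of the domain.\<close>

definition limiting_subdiff :: "('a::real_inner \<Rightarrow> ereal) \<Rightarrow> 'a \<Rightarrow> 'a set" where
  "limiting_subdiff g x =
     {v. x \<in> eff_dom g \<and>
         (\<exists>u w. u \<longlonglongrightarrow> x \<and> (\<lambda>k. g (u k)) \<longlonglongrightarrow> g x \<and>
                (\<forall>k::nat. w k \<in> frechet_subdiff g (u k)) \<and> w \<longlonglongrightarrow> v)}"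

definition dom_subdiff :: "('a::real_inner \<Rightarrow> ereal) \<Rightarrow> 'a set" where
  "dom_subdiff g = {x. limiting_subdiff g x \<noteq> {}}"

definition critical_point :: "('a::real_inner \<Rightarrow> ereal) \<Rightarrow> 'a \<Rightarrow> bool" where
  "critical_point g x \<longleftrightarrow> x \<in> eff_dom g \<and> 0 \<in> limiting_subdiff g x"

text \<open>The infimum is \<open>\<infinity>\<close> for the empty set. For the limiting subdifferential of a proper function
  it is a minimum whenever the set is nonempty, see \<open>dist_zero_limiting_subdiff_attained\<close> below.\<close>

definition dist_zero :: "'a::real_normed_vector set \<Rightarrow> ereal" where
  "dist_zero S = (INF y\<in>S. ereal (norm y))"

text \<open>\<open>\<eta>\<close> may be \<open>\<infinity>\<close>, so the interval from 0 (included) to \<open>\<eta>\<close> (excluded) is written as a set of reals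
  \<open>t\<close> with \<open>ereal t < \<eta>\<close>. Only the values of \<open>\<xi>\<close> on that interval are relevant.\<close>

definition desingularizing :: "ereal \<Rightarrow> (real \<Rightarrow> real) \<Rightarrow> bool" where
  "desingularizing \<eta> \<xi> \<longleftrightarrow>
     (let I = {t. 0 \<le> t \<and> ereal t < \<eta>}; J = {t. 0 < t \<and> ereal t < \<eta>} in
        concave_on I \<xi> \<and> (\<forall>t\<in>I. 0 \<le> \<xi> t) \<and>
        \<xi> C1_differentiable_on J \<and> continuous (at 0 within I) \<xi> \<and> \<xi> 0 = 0 \<and>
        (\<forall>t\<in>J. 0 < deriv \<xi> t))"

text \<open>At points of the domain of the limiting subdifferential of a proper function, \<open>\<phi> xb\<close> is finite;
  then \<open>\<phi> x - \<phi> xb\<close> is finite too under the stated bounds, so \<open>real_of_ereal\<close> is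
  harmless.\<close>

definition KL_property_at :: "('a::real_inner \<Rightarrow> ereal) \<Rightarrow> 'a \<Rightarrow> bool" where
  "KL_property_at \<phi> xb \<longleftrightarrow>
     (\<exists>\<eta> U \<xi>. 0 < \<eta> \<and> xb \<in> interior U \<and> desingularizing \<eta> \<xi> \<and>
        (\<forall>x\<in>U. \<phi> xb < \<phi> x \<and> \<phi> x < \<phi> xb + \<eta> \<longrightarrow>
           1 \<le> ereal (deriv \<xi> (real_of_ereal (\<phi> x - \<phi> xb))) * dist_zero (limiting_subdiff \<phi> x)))"

definition KL_function :: "('a::real_inner \<Rightarrow> ereal) \<Rightarrow> bool" where
  "KL_function \<phi> \<longleftrightarrow> (\<forall>xb\<in>dom_subdiff \<phi>. KL_property_at \<phi> xb)"

lemma limiting_subdiff_approx: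
  assumes "proper g"
  shows "v \<in> limiting_subdiff g x \<longleftrightarrow> x \<in> eff_dom g \<and>
     (\<forall>e>0. \<exists>u w. w \<in> frechet_subdiff g u \<and> dist u x < e \<and> dist w v < e \<and>
        \<bar>real_of_ereal (g u) - real_of_ereal (g x)\<bar> < e)"
proof (intro iffI conjI allI impI)
  assume "v \<in> limiting_subdiff g x"
  then show "x \<in> eff_dom g" by (simp add: limiting_subdiff_def)
next
  fix e :: real assume e: "e > 0" and v: "v \<in> limiting_subdiff g x"
  from v obtain u w where *: "x \<in> eff_dom g" "u \<longlonglongrightarrow> x" "(\<lambda>k. g (u k)) \<longlonglongrightarrow> g x"
    "\<And>k::nat. w k \<in> frechet_subdiff g (u k)" "w \<longlonglongrightarrow> v"
    by (auto simp: limiting_subdiff_def)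
  have "g x \<noteq> \<infinity>" "g x \<noteq> -\<infinity>" using * assms by (auto simp: eff_dom_def proper_def)
  then have "\<bar>g x\<bar> \<noteq> \<infinity>" by auto
  then have "((\<lambda>k. real_of_ereal (g (u k))) \<longlonglongrightarrow> real_of_ereal (g x))"
    using *(3) by (intro lim_real_of_ereal) (simp add: ereal_real')
  then have "eventually (\<lambda>k. dist (u k) x < e \<and> dist (w k) v < e \<and>
      \<bar>real_of_ereal (g (u k)) - real_of_ereal (g x)\<bar> < e) sequentially"
    using *(2,5) e by (auto simp: tendsto_iff dist_real_def intro!: eventually_conj)
  then obtain k where "dist (u k) x < e \<and> dist (w k) v < e \<and>
      \<bar>real_of_ereal (g (u k)) - real_of_ereal (g x)\<bar> < e"
    by (auto simp: eventually_sequentially)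
  with *(4) show "\<exists>u w. w \<in> frechet_subdiff g u \<and> dist u x < e \<and> dist w v < e \<and>
        \<bar>real_of_ereal (g u) - real_of_ereal (g x)\<bar> < e" by blast
next
  assume A: "x \<in> eff_dom g \<and>
     (\<forall>e>0. \<exists>u w. w \<in> frechet_subdiff g u \<and> dist u x < e \<and> dist w v < e \<and>
        \<bar>real_of_ereal (g u) - real_of_ereal (g x)\<bar> < e)"
  then have "\<exists>u w. w \<in> frechet_subdiff g u \<and> dist u x < 1 / real (Suc k) \<and>
      dist w v < 1 / real (Suc k) \<and>
      \<bar>real_of_ereal (g u) - real_of_ereal (g x)\<bar> < 1 / real (Suc k)" for k
    by (elim conjE allE[of _ "1 / real (Suc k)"]) simp
  then obtain u w where *: "\<And>k::nat. w k \<in> frechet_subdiff g (u k)"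
    "\<And>k. dist (u k) x < 1 / real (Suc k)" "\<And>k. dist (w k) v < 1 / real (Suc k)"
    "\<And>k. \<bar>real_of_ereal (g (u k)) - real_of_ereal (g x)\<bar> < 1 / real (Suc k)"
    by metis
  have lim: "(\<lambda>k. 1 / real (Suc k)) \<longlonglongrightarrow> 0"
    using LIMSEQ_inverse_real_of_nat by (simp add: inverse_eq_divide)
  have conv: "f \<longlonglongrightarrow> l" if "\<And>k. dist (f k) l < 1 / real (Suc k)"
    for f :: "nat \<Rightarrow> 'b::metric_space" and l
  proof -
    have "(\<lambda>k. dist (f k) l) \<longlonglongrightarrow> 0"
      by (rule tendsto_sandwich[OF _ _ tendsto_const lim]) (use that in \<open>auto intro!: always_eventually less_imp_le simp del: of_nat_Suc\<close>)
    then show ?thesis by (subst tendsto_dist_iff)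
  qed
  have "(\<lambda>k. real_of_ereal (g (u k))) \<longlonglongrightarrow> real_of_ereal (g x)"
    by (rule conv) (use *(4) in \<open>simp add: dist_real_def del: of_nat_Suc\<close>)
  then have "(\<lambda>k. ereal (real_of_ereal (g (u k)))) \<longlonglongrightarrow> ereal (real_of_ereal (g x))"
    by (rule tendsto_ereal)
  moreover have "ereal (real_of_ereal (g y)) = g y" if "y \<in> eff_dom g" for y
    using that assms by (intro ereal_real') (auto simp: eff_dom_def proper_def)
  moreover have "u k \<in> eff_dom g" for k
    using *(1)[of k] by (simp add: frechet_subdiff_def)
  ultimately have "(\<lambda>k. g (u k)) \<longlonglongrightarrow> g x" using A by simp
  then show "v \<in> limiting_subdiff g x"
    unfolding limiting_subdiff_def using A *(1) conv[OF *(2)] conv[OF *(3)]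
    by (intro CollectI conjI exI[of _ u] exI[of _ w]) auto
qed

lemma closed_limiting_subdiff:
  assumes "proper g"
  shows "closed (limiting_subdiff g x)"
  unfolding closed_sequential_limits
proof (intro allI impI)
  fix f v assume f: "(\<forall>n. f n \<in> limiting_subdiff g x) \<and> f \<longlonglongrightarrow> v"
  have "\<exists>u w. w \<in> frechet_subdiff g u \<and> dist u x < e \<and> dist w v < e \<and>
        \<bar>real_of_ereal (g u) - real_of_ereal (g x)\<bar> < e" if e: "e > 0" for e
  proof -
    obtain n where n: "dist (f n) v < e/2"
      using f e by (metis half_gt_zero metric_LIMSEQ_D order_refl)
    obtain u w where uw: "w \<in> frechet_subdiff g u" "dist u x < e/2" "dist w (f n) < e/2"
        "\<bar>real_of_ereal (g u) - real_of_ereal (g x)\<bar> < e/2"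
      using f half_gt_zero[OF e] unfolding limiting_subdiff_approx[OF assms] by blast
    have "dist w v < e" using uw(3) n dist_triangle[of w v "f n"] by simp
    then show ?thesis using uw e by (intro exI[of _ u] exI[of _ w]) auto
  qed
  then show "v \<in> limiting_subdiff g x"
    using f unfolding limiting_subdiff_approx[OF assms] by blast
qed

lemma dist_zero_limiting_subdiff_attained:
  fixes g :: "'a::euclidean_space \<Rightarrow> ereal"
  assumes "proper g" "limiting_subdiff g x \<noteq> {}"
  shows "\<exists>y\<in>limiting_subdiff g x. dist_zero (limiting_subdiff g x) = ereal (norm y) \<and>
           (\<forall>y'\<in>limiting_subdiff g x. norm y \<le> norm y')"
proof -
  obtain y where y: "y \<in> limiting_subdiff g x" "\<And>y'. y' \<in> limiting_subdiff g x \<Longrightarrow> dist 0 y \<le> dist 0 y'"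
    using distance_attains_inf[OF closed_limiting_subdiff[OF assms(1)] assms(2), where a = 0] by auto
  have "dist_zero (limiting_subdiff g x) = ereal (norm y)"
    unfolding dist_zero_def
    using y by (intro antisym INF_lower INF_greatest) (auto simp: dist_norm)
  with y show ?thesis by auto
qed

end

theory Submission
  imports Defs
begin

text \<open>The values \<open>\<Phi> (z k)\<close> decrease to a limit \<open>L\<close>, which is also the value of \<open>\<Phi>\<close> at any cluster
  point \<open>zb\<close>, and \<open>zb\<close> is critical because the subgradients \<open>w k\<close> tend to 0. While the iterates
  stay in the neighbourhood of \<open>zb\<close> given by the KL property, concavity of \<open>\<xi>\<close> turns sufficient
  decrease into \<open>2 * \<zeta> (k + 1) \<le> \<zeta> k + C * (\<xi> (\<Phi> (z (k + 1)) - L) - \<xi> (\<Phi> (z (k + 2)) - L))\<close>.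
  Summing bounds the length of the trajectory by quantities that are small when it starts late and
  close to \<open>zb\<close>. Hence it never leaves the neighbourhood, and the KL property at the single point
  \<open>zb\<close> suffices.\<close>

section \<open>Desingularizing functions and the KL inequality\<close>

lemma ex_ereal_between_zero:
  fixes \<eta> :: ereal
  assumes "0 < \<eta>"
  obtains h where "0 < h" "ereal h < \<eta>"
  using ereal_dense2[OF assms] by (auto simp: zero_ereal_def)

lemma desingularizing_has_deriv:
  assumes "desingularizing \<eta> \<xi>" "0 < t" "ereal t < \<eta>"
  shows "(\<xi> has_field_derivative deriv \<xi> t) (at t)"
proof -
  have "\<xi> differentiable (at t)"
    using assms unfolding desingularizing_def Let_def C1_differentiable_on_eq by blast
  then show ?thesis
    by (metis DERIV_imp_deriv real_differentiable_def)
qed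

text \<open>The tangent inequality of the convex function \<open>- \<xi>\<close>, read backwards.
  Only \<open>t\<close> has to be interior to the interval; \<open>s\<close> may be the endpoint 0,
  the value reached by \<open>\<Phi> - L\<close> in the limit.\<close>

lemma desingularizing_tangent:
  assumes xi: "desingularizing \<eta> \<xi>" and st: "0 \<le> s" "ereal s < \<eta>" "0 < t" "ereal t < \<eta>"
  shows "deriv \<xi> t * (t - s) \<le> \<xi> t - \<xi> s"
proof -
  define I where "I = {t. 0 \<le> t \<and> ereal t < \<eta>}"
  have "convex_on I (\<lambda>t. - \<xi> t)"
    using xi unfolding desingularizing_def Let_def concave_on_def I_def by blast
  moreover have "connected I"
  proof (rule connectedI_interval)
    fix a b c assume "a \<in> I" "b \<in> I" "a \<le> c" "c \<le> b"
    then show "c \<in> I" unfolding I_def using order.strict_trans1[of "ereal c" "ereal b" \<eta>] by auto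
  qed
  moreover have "t \<in> interior I"
  proof -
    obtain u where u: "t < u" "ereal u < \<eta>" using ereal_dense2[OF st(4)] by auto
    have "{0<..<u} \<subseteq> I"
      unfolding I_def using u(2) by (auto intro: order.strict_trans[of _ "ereal u"])
    then show ?thesis using u st(3) by (meson greaterThanLessThan_iff interiorI open_greaterThanLessThan)
  qed
  moreover have "s \<in> I" using st by (simp add: I_def)
  moreover have "((\<lambda>t. - \<xi> t) has_field_derivative - deriv \<xi> t) (at t within I)"
    using desingularizing_has_deriv[OF xi st(3,4)]
    by (intro DERIV_minus) (rule has_field_derivative_at_within)
  ultimately have "- \<xi> s - - \<xi> t \<ge> - deriv \<xi> t * (s - t)"
    by (rule convex_on_imp_above_tangent)
  then show ?thesis by (simp add: algebra_simps)
qed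

lemma desingularizing_tendsto_zero:
  assumes xi: "desingularizing \<eta> \<xi>" and "0 < \<eta>"
    and "\<And>k. 0 \<le> s k" "s \<longlonglongrightarrow> 0"
  shows "(\<lambda>k. \<xi> (s k)) \<longlonglongrightarrow> 0"
proof -
  define I where "I = {t. 0 \<le> t \<and> ereal t < \<eta>}"
  have lim: "continuous (at 0 within I) \<xi>" and 0: "\<xi> 0 = 0"
    using xi unfolding desingularizing_def Let_def I_def by blast+
  obtain h where h: "0 < h" "ereal h < \<eta>" using ex_ereal_between_zero[OF \<open>0 < \<eta>\<close>] .
  have "\<forall>\<^sub>F k in sequentially. s k < h" using assms(4) h(1) by (rule order_tendstoD)
  then have "\<forall>\<^sub>F k in sequentially. s k \<in> I"
    by eventually_elim (use assms(3) h(2) in \<open>auto simp: I_def intro: order.strict_trans[of _ "ereal h"]\<close>)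
  with lim have "(\<lambda>k. \<xi> (s k)) \<longlonglongrightarrow> \<xi> 0"
    using assms(4) by (rule continuous_within_tendsto_compose)
  with 0 show ?thesis by simp
qed

text \<open>Trades the extended-real distance for the norm of one known subgradient: the infimum is
  at most \<open>norm v\<close>, and the positive factor \<open>deriv \<xi> (l - L)\<close>
  preserves this. All later estimates are then purely real.\<close>

lemma KL_inequality:
  assumes "proper \<phi>" "desingularizing \<eta> \<xi>"
    and KL: "\<phi> xb < \<phi> x \<and> \<phi> x < \<phi> xb + \<eta> \<longrightarrow>
      1 \<le> ereal (deriv \<xi> (real_of_ereal (\<phi> x - \<phi> xb))) * dist_zero (limiting_subdiff \<phi> x)"
    and v: "v \<in> limiting_subdiff \<phi> x"
    and r: "\<phi> xb = ereal L" "\<phi> x = ereal l" "L < l" "ereal (l - L) < \<eta>"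
  shows "1 \<le> deriv \<xi> (l - L) * norm v"
proof -
  have "\<phi> x < \<phi> xb + \<eta>" using r by (cases \<eta>) auto
  with KL r have "1 \<le> ereal (deriv \<xi> (l - L)) * dist_zero (limiting_subdiff \<phi> x)" by simp
  also have "\<dots> \<le> ereal (deriv \<xi> (l - L)) * ereal (norm v)"
  proof (rule ereal_mult_left_mono)
    show "dist_zero (limiting_subdiff \<phi> x) \<le> ereal (norm v)"
      unfolding dist_zero_def using v by (rule INF_lower)
    have "0 < deriv \<xi> (l - L)"
      using assms(2) r unfolding desingularizing_def Let_def by auto
    then show "0 \<le> ereal (deriv \<xi> (l - L))" by simp
  qed
  finally show ?thesis by simp
qed

section \<open>Closedness of the limiting subdifferential\<close>

text \<open>A diagonal argument without a diagonal sequence: by the epsilon characterization, a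
  Frechet subgradient within \<open>e / 2\<close> of a late \<open>w k\<close> is within
  \<open>e\<close> of \<open>v\<close>, and likewise for points and values. It makes cluster points
  of the iterates critical.\<close>

lemma limiting_subdiff_closed_graph:
  assumes g: "proper g" and x: "x \<in> eff_dom g"
    and u: "u \<longlonglongrightarrow> x" "(\<lambda>k. g (u k)) \<longlonglongrightarrow> g x"
    and w: "\<And>k. w k \<in> limiting_subdiff g (u k)" "w \<longlonglongrightarrow> v"
  shows "v \<in> limiting_subdiff g x"
  unfolding limiting_subdiff_approx[OF g]
proof (intro conjI allI impI x)
  fix e :: real assume "e > 0"
  then have e: "e / 2 > 0" by simp
  have "\<bar>g x\<bar> \<noteq> \<infinity>" using x g by (auto simp: eff_dom_def proper_def)
  then have "(\<lambda>k. real_of_ereal (g (u k))) \<longlonglongrightarrow> real_of_ereal (g x)"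
    using u(2) by (intro lim_real_of_ereal) (simp add: ereal_real')
  then have "\<forall>\<^sub>F k in sequentially. dist (u k) x < e / 2 \<and> dist (w k) v < e / 2 \<and>
      dist (real_of_ereal (g (u k))) (real_of_ereal (g x)) < e / 2"
    using u(1) w(2) e by (intro eventually_conj tendstoD)
  then obtain k where k: "dist (u k) x < e / 2" "dist (w k) v < e / 2"
      "dist (real_of_ereal (g (u k))) (real_of_ereal (g x)) < e / 2"
    by (auto simp: eventually_sequentially)
  obtain u' w' where uw: "w' \<in> frechet_subdiff g u'" "dist u' (u k) < e / 2" "dist w' (w k) < e / 2"
      "\<bar>real_of_ereal (g u') - real_of_ereal (g (u k))\<bar> < e / 2"
    using w(1)[of k] e unfolding limiting_subdiff_approx[OF g] by blast
  have "dist u' x < e" using dist_triangle[of u' x "u k"] uw k by linarith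
  moreover have "dist w' v < e" using dist_triangle[of w' v "w k"] uw k by linarith
  moreover have "\<bar>real_of_ereal (g u') - real_of_ereal (g x)\<bar> < e"
    using uw(4) k(3) unfolding dist_real_def by linarith
  ultimately show "\<exists>u w. w \<in> frechet_subdiff g u \<and> dist u x < e \<and> dist w v < e \<and>
      \<bar>real_of_ereal (g u) - real_of_ereal (g x)\<bar> < e"
    using uw(1) by blast
qed

section \<open>The descent recursion and the trapping argument\<close>

text \<open>The inequality of arithmetic and geometric means in a form free of square roots.\<close>

lemma two_mult_le_add_of_square_le:
  fixes x a b :: real
  assumes "x\<^sup>2 \<le> a * b" "0 \<le> a" "0 \<le> b"
  shows "2 * x \<le> a + b"
proof (rule power2_le_imp_le)
  have "4 * (a * b) \<le> (a + b)\<^sup>2"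
    using zero_le_power2[of "a - b"] by (simp add: power2_eq_square algebra_simps)
  then show "(2 * x)\<^sup>2 \<le> (a + b)\<^sup>2"
    using assms(1) by (simp add: power_mult_distrib)
qed (use assms in simp)

text \<open>Here \<open>a\<close> and \<open>b\<close> stand for consecutive \<open>\<zeta>\<close>,
  \<open>l\<close> and \<open>l'\<close> for consecutive values of \<open>\<Phi>\<close>,
  \<open>d\<close> for the slope of \<open>\<xi>\<close>, and \<open>D\<close> for the drop of
  \<open>\<xi>\<close>. Multiplying the decrease by the KL inequality replaces \<open>l - l'\<close>
  by \<open>D * (\<rho> * a)\<close>, so \<open>b\<close> squared is at most \<open>a\<close> times
  a telescoping quantity.\<close>

lemma KL_descent_step:
  fixes a b c d l l' :: real
  assumes "1 \<le> d * (\<rho> * a)" "d * (l - l') \<le> D" "\<sigma> * b\<^sup>2 \<le> l - l'"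
    and pos: "0 \<le> a" "0 < \<rho>" "0 < \<sigma>"
  shows "2 * b \<le> a + \<rho> / \<sigma> * D"
proof (rule two_mult_le_add_of_square_le)
  have l: "0 \<le> l - l'" using assms(3) pos(3) by (smt (verit) zero_le_power2 mult_nonneg_nonneg)
  \<comment> \<open>A negative \<open>d\<close> would make the product in the first assumption
    nonpositive.\<close>
  have d: "0 \<le> d" using assms(1) pos
    by (smt (verit) mult_nonneg_nonneg mult_nonpos_nonneg)
  have "\<sigma> * b\<^sup>2 \<le> (l - l') * (d * (\<rho> * a))"
    using assms(3) mult_left_mono[OF assms(1) l, unfolded mult_1_right] by (rule order_trans)
  also have "\<dots> = (d * (l - l')) * (\<rho> * a)" by (rule mult.assoc[symmetric, THEN trans]) (simp only: mult.commute)
  also have "\<dots> \<le> D * (\<rho> * a)" using assms(2) pos by (intro mult_right_mono) auto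
  finally show "b\<^sup>2 \<le> a * (\<rho> / \<sigma> * D)" using pos(3) by (simp add: pos_le_divide_eq mult.commute mult.left_commute)
  have "0 \<le> D" using assms(2) mult_nonneg_nonneg[OF d l] by linarith
  then show "0 \<le> \<rho> / \<sigma> * D" using pos by simp
qed (rule pos(1))

text \<open>Of the two copies of \<open>a (Suc k)\<close> in \<open>step\<close>, one joins the
  partial sum and the other replaces \<open>a k\<close>, while \<open>b\<close> telescopes. So the
  partial sums stay below \<open>a 0 + b 0\<close>, and by \<open>start\<close> the path is too
  short to leave the ball.\<close>

lemma summable_of_captured:
  fixes x :: "nat \<Rightarrow> 'a::metric_space" and a b :: "nat \<Rightarrow> real"
  assumes nonneg: "\<And>k. 0 \<le> a k" "\<And>k. 0 \<le> b k" "0 \<le> M"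
    and dist: "\<And>k. dist (x k) (x (Suc k)) \<le> M * a (Suc k)"
    and step: "\<And>k. x k \<in> ball c \<delta> \<Longrightarrow> 2 * a (Suc k) \<le> a k + (b k - b (Suc k))"
    and start: "dist (x 0) c + M * (a 0 + b 0) < \<delta>"
  shows "summable a"
proof -
  \<comment> \<open>Both bounds need a joint induction: the sum bound keeps \<open>x n\<close> in
    the ball, and only there does \<open>step\<close> extend the sum bound to the next
    index.\<close>
  have inv: "dist (x n) c \<le> dist (x 0) c + M * (\<Sum>k<n. a (Suc k)) \<and>
      (\<Sum>k<n. a (Suc k)) + a n + b n \<le> a 0 + b 0" for n
  proof (induction n)
    case (Suc n)
    have "M * (\<Sum>k<n. a (Suc k)) \<le> M * (a 0 + b 0)"
      using Suc nonneg(1)[of n] nonneg(2)[of n] by (intro mult_left_mono nonneg(3)) linarith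
    then have "x n \<in> ball c \<delta>" using Suc start by (simp add: dist_commute)
    from step[OF this] Suc
    have "(\<Sum>k<Suc n. a (Suc k)) + a (Suc n) + b (Suc n) \<le> a 0 + b 0" by simp
    moreover have "dist (x (Suc n)) c \<le> dist (x n) c + M * a (Suc n)"
      using dist[of n] dist_triangle3[of "x (Suc n)" c "x n"] by linarith
    then have "dist (x (Suc n)) c \<le> dist (x 0) c + M * (\<Sum>k<Suc n. a (Suc k))"
      using Suc by (simp add: distrib_left)
    ultimately show ?case by blast
  qed simp
  have "summable (\<lambda>k. a (Suc k))"
  proof (rule bounded_imp_summable)
    show "(\<Sum>k\<le>n. a (Suc k)) \<le> a 0 + b 0" for n
      using inv[of "Suc n"] nonneg(1)[of "Suc n"] nonneg(2)[of "Suc n"]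
      unfolding lessThan_Suc_atMost by linarith
  qed (rule nonneg)
  then show ?thesis by (rule summable_Suc_iff[THEN iffD1])
qed

lemma convergent_of_summable_steps:
  fixes x :: "nat \<Rightarrow> 'a::banach"
  assumes "summable a" "\<And>k. norm (x k - x (Suc k)) \<le> a k"
  shows "convergent x"
proof -
  have "summable (\<lambda>k. x (Suc k) - x k)"
    using assms(1)
    by (rule summable_comparison_test'[where N = 0]) (subst norm_minus_commute, rule assms(2))
  then have "convergent (\<lambda>n. x n - x 0)"
    unfolding summable_iff_convergent sum_lessThan_telescope .
  from convergent_add[OF this convergent_const[of "x 0"]] show ?thesis
    unfolding diff_add_cancel .
qed

theorem theorem2:
  fixes \<Phi> :: "real ^ 'n \<Rightarrow> ereal"
    and \<A> :: "real ^ 'n \<Rightarrow> (real ^ 'n) set"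
    and z :: "nat \<Rightarrow> real ^ 'n"
    and \<zeta> :: "nat \<Rightarrow> real"
    and \<rho>\<^sub>1 \<rho>\<^sub>2 \<rho>\<^sub>3 :: real
  assumes "proper \<Phi>" and "lsc \<Phi>" and "bounded_from_below \<Phi>"
    and algorithm: "\<And>k. z (Suc k) \<in> \<A> (z k)"
    and bounded_seq: "bounded (range z)"
    and "0 < \<rho>\<^sub>1" and "0 < \<rho>\<^sub>2" and "0 < \<rho>\<^sub>3"
    and "\<And>k. 0 \<le> \<zeta> k"
    and B1: "\<And>k. \<rho>\<^sub>1 * (norm (z k - z (Suc k)))\<^sup>2 \<le> \<rho>\<^sub>2 * (\<zeta> k)\<^sup>2 \<and>
                  ereal (\<rho>\<^sub>2 * (\<zeta> k)\<^sup>2) \<le> \<Phi> (z k) - \<Phi> (z (Suc k))"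
    and B2: "\<exists>w. (\<forall>k. w k \<in> limiting_subdiff \<Phi> (z k)) \<and> (\<forall>k. norm (w (Suc k)) \<le> \<rho>\<^sub>3 * \<zeta> k)"
    and B3: "KL_function \<Phi>"
    and B4: "\<And>r zb. strict_mono r \<Longrightarrow> (\<lambda>n. z (r n)) \<longlonglongrightarrow> zb \<Longrightarrow>
                  (\<lambda>n. \<Phi> (z (r n))) \<longlonglongrightarrow> \<Phi> zb"
  shows "summable (\<lambda>k. \<zeta> (Suc k)) \<and> (\<exists>zb. z \<longlonglongrightarrow> zb \<and> critical_point \<Phi> zb)"
proof -

  \<comment> \<open>Monotone values and vanishing subgradients\<close>
  obtain w where w: "\<And>k. w k \<in> limiting_subdiff \<Phi> (z k)"
    and w_le: "\<And>k. norm (w (Suc k)) \<le> \<rho>\<^sub>3 * \<zeta> k"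
    using B2 by blast
  obtain m where m: "\<And>x. ereal m \<le> \<Phi> x"
    using \<open>bounded_from_below \<Phi>\<close> unfolding bounded_from_below_def by blast
  have nonneg: "0 \<le> \<zeta> k" for k by fact
  define \<phi> where "\<phi> k = real_of_ereal (\<Phi> (z k))" for k
  have \<phi>: "\<Phi> (z k) = ereal (\<phi> k)" for k
  proof -
    have "\<Phi> (z k) < \<infinity>" using w[of k] by (simp add: limiting_subdiff_def eff_dom_def)
    moreover have "\<Phi> (z k) \<noteq> -\<infinity>" using \<open>proper \<Phi>\<close> by (simp add: proper_def)
    ultimately show ?thesis by (cases "\<Phi> (z k)") (auto simp: \<phi>_def)
  qed
  have dec: "\<rho>\<^sub>2 * (\<zeta> k)\<^sup>2 \<le> \<phi> k - \<phi> (Suc k)" for k using B1[of k] by (simp add: \<phi>)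
  have "decseq \<phi>"
  proof (rule decseq_SucI)
    fix k
    have "0 \<le> \<rho>\<^sub>2 * (\<zeta> k)\<^sup>2" using \<open>0 < \<rho>\<^sub>2\<close> by simp
    then show "\<phi> (Suc k) \<le> \<phi> k" using dec[of k] by linarith
  qed
  moreover have "m \<le> \<phi> k" for k using m[of "z k"] by (simp add: \<phi>)
  ultimately obtain L where L: "\<phi> \<longlonglongrightarrow> L" and L_le: "\<And>k. L \<le> \<phi> k"
    using decseq_convergent by metis

  \<comment> \<open>Successive differences of a convergent sequence tend to 0 and dominate the
    squares of \<open>\<zeta>\<close>.\<close>
  have "(\<lambda>k. (\<phi> k - \<phi> (Suc k)) / \<rho>\<^sub>2) \<longlonglongrightarrow> (L - L) / \<rho>\<^sub>2"
    using \<open>0 < \<rho>\<^sub>2\<close> by (intro tendsto_intros L LIMSEQ_Suc) auto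
  moreover have "(\<zeta> k)\<^sup>2 \<le> (\<phi> k - \<phi> (Suc k)) / \<rho>\<^sub>2" for k
    using dec[of k] \<open>0 < \<rho>\<^sub>2\<close> by (simp add: field_simps)
  ultimately have "(\<lambda>k. (\<zeta> k)\<^sup>2) \<longlonglongrightarrow> 0"
    by (intro Lim_null_comparison[where f = "\<lambda>k. (\<zeta> k)\<^sup>2"]) auto
  then have \<zeta>_lim: "\<zeta> \<longlonglongrightarrow> 0"
    using tendsto_real_sqrt[of "\<lambda>k. (\<zeta> k)\<^sup>2" 0 sequentially] nonneg by simp
  have "(\<lambda>k. w (Suc k)) \<longlonglongrightarrow> 0"
  proof (rule Lim_null_comparison)
    show "(\<lambda>k. \<rho>\<^sub>3 * \<zeta> k) \<longlonglongrightarrow> 0" using tendsto_mult_right_zero[OF \<zeta>_lim] .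
  qed (use w_le in simp)
  then have w_lim: "w \<longlonglongrightarrow> 0" by (rule LIMSEQ_imp_Suc)

  \<comment> \<open>A critical cluster point\<close>
  obtain zb r where r: "strict_mono r" "(\<lambda>n. z (r n)) \<longlonglongrightarrow> zb"
    using bounded_imp_convergent_subsequence[OF bounded_seq] by (auto simp: o_def)
  have sub: "(\<lambda>n. f (r n)) \<longlonglongrightarrow> l" if "f \<longlonglongrightarrow> l" for f :: "nat \<Rightarrow> 'b::topological_space" and l
    using LIMSEQ_subseq_LIMSEQ[OF that r(1)] by (simp add: o_def)
  have \<Phi>_lim: "(\<lambda>n. \<Phi> (z (r n))) \<longlonglongrightarrow> \<Phi> zb" using B4 r by blast
  moreover have "(\<lambda>n. \<Phi> (z (r n))) \<longlonglongrightarrow> ereal L"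
    using sub[OF L] by (simp add: \<phi>)
  ultimately have zb: "\<Phi> zb = ereal L" by (rule LIMSEQ_unique)
  then have dom: "zb \<in> eff_dom \<Phi>" by (simp add: eff_dom_def)
  have "0 \<in> limiting_subdiff \<Phi> zb"
    using \<open>proper \<Phi>\<close> dom r(2) \<Phi>_lim w sub[OF w_lim]
    by (rule limiting_subdiff_closed_graph)
  then have crit: "critical_point \<Phi> zb" and "zb \<in> dom_subdiff \<Phi>"
    using dom by (auto simp: critical_point_def dom_subdiff_def)
  then have "KL_property_at \<Phi> zb" using B3 by (simp add: KL_function_def)

  \<comment> \<open>The constant obtained by taking square roots in the first inequality of (B1); it
    bounds step lengths by \<open>\<zeta>\<close>.\<close>
  define M where "M = sqrt (\<rho>\<^sub>2 / \<rho>\<^sub>1)"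
  have M: "0 \<le> M" using \<open>0 < \<rho>\<^sub>1\<close> \<open>0 < \<rho>\<^sub>2\<close> by (simp add: M_def)
  have step_le: "norm (z k - z (Suc k)) \<le> M * \<zeta> k" for k
  proof (rule power2_le_imp_le)
    show "(norm (z k - z (Suc k)))\<^sup>2 \<le> (M * \<zeta> k)\<^sup>2"
      using B1[of k] \<open>0 < \<rho>\<^sub>1\<close> \<open>0 < \<rho>\<^sub>2\<close> by (simp add: M_def power_mult_distrib field_simps)
  qed (use M nonneg in simp)

  \<comment> \<open>Summability and convergence\<close>
  have "summable \<zeta>"
  proof (cases "\<exists>N. \<phi> N = L")
    \<comment> \<open>The KL inequality speaks only of values strictly above \<open>L\<close>. If
      \<open>L\<close> is attained, the decreasing values are constant from then on, and (B1) forces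
      \<open>\<zeta>\<close> to vanish.\<close>
    case True
    then obtain N where "\<phi> N = L" ..
    then have "\<phi> k = L" if "k \<ge> N" for k
      using L_le[of k] decseqD[OF \<open>decseq \<phi>\<close> that] by simp
    then have "\<zeta> k = 0" if "k \<ge> N" for k
      using that dec[of k] \<open>0 < \<rho>\<^sub>2\<close> by (simp add: mult_le_0_iff)
    then show ?thesis
      by (intro summable_finite[of "{..<N}"]) (auto simp: not_less)
  next
    case False
    then have L_less: "L < \<phi> k" for k using L_le[of k] by (metis order_le_less)
    from \<open>KL_property_at \<Phi> zb\<close> obtain \<eta> U \<xi> where \<eta>: "0 < \<eta>" and "zb \<in> interior U"
      and \<xi>: "desingularizing \<eta> \<xi>"
      and KL: "\<And>x. x \<in> U \<Longrightarrow> \<Phi> zb < \<Phi> x \<and> \<Phi> x < \<Phi> zb + \<eta> \<longrightarrow>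
           1 \<le> ereal (deriv \<xi> (real_of_ereal (\<Phi> x - \<Phi> zb))) * dist_zero (limiting_subdiff \<Phi> x)"
      unfolding KL_property_at_def by blast
    then obtain \<delta> where \<delta>: "0 < \<delta>" "ball zb \<delta> \<subseteq> U" by (auto simp: mem_interior)
    obtain h where h: "0 < h" "ereal h < \<eta>" using ex_ereal_between_zero[OF \<eta>] .
    define C where "C = \<rho>\<^sub>3 / \<rho>\<^sub>2"
    have C: "0 \<le> C" using \<open>0 < \<rho>\<^sub>2\<close> \<open>0 < \<rho>\<^sub>3\<close> by (simp add: C_def)
    have gap: "(\<lambda>k. \<phi> k - L) \<longlonglongrightarrow> 0" using L by (simp add: LIM_zero)
    then have "\<forall>\<^sub>F k in sequentially. \<phi> k - L < h" using h(1) by (rule order_tendstoD)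
    then obtain K where "\<And>k. k \<ge> K \<Longrightarrow> \<phi> k - L < h" by (auto simp: eventually_sequentially)
    then have in_\<eta>: "ereal (\<phi> k - L) < \<eta>" if "k \<ge> K" for k
      using that h(2) by (metis less_ereal.simps(1) order.strict_trans)
    have \<xi>_lim: "(\<lambda>k. \<xi> (\<phi> k - L)) \<longlonglongrightarrow> 0"
      using \<xi> \<eta> _ gap by (rule desingularizing_tendsto_zero) (use L_le in simp)

    \<comment> \<open>The trapped path starts at an iterate \<open>z (r (Suc n))\<close>, whose
      subgradient is bounded through the preceding \<open>\<zeta>\<close>. Taking
      \<open>Suc n\<close> makes the index positive, so the natural subtraction is exact.\<close>
    define s where "s n = r (Suc n) - 1" for n
    have Suc_s: "Suc (s n) = r (Suc n)" for n
      using strict_mono_imp_increasing[OF r(1), of "Suc n"] by (simp add: s_def)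
    have s: "n \<le> s n" for n
      using strict_mono_imp_increasing[OF r(1), of "Suc n"] by (simp add: s_def)
    then have s_top: "filterlim s at_top sequentially"
      by (intro filterlim_at_top_mono[OF filterlim_ident]) auto
    \<comment> \<open>Every term of the starting condition vanishes along the subsequence, so a late
      enough \<open>n\<close> meets it.\<close>
    have "(\<lambda>n. dist (z (r (Suc n))) zb + M * (\<zeta> (s n) + C * \<xi> (\<phi> (r (Suc n)) - L)))
        \<longlonglongrightarrow> 0 + M * (0 + C * 0)"
      using LIMSEQ_Suc[OF r(2)]
      by (intro tendsto_intros filterlim_compose[OF \<zeta>_lim s_top] LIMSEQ_Suc[OF sub[OF \<xi>_lim]])
         (simp add: tendsto_dist_iff[symmetric])
    then have "\<forall>\<^sub>F n in sequentially.
        dist (z (r (Suc n))) zb + M * (\<zeta> (s n) + C * \<xi> (\<phi> (r (Suc n)) - L)) < \<delta>"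
      using \<delta>(1) by (intro order_tendstoD) auto
    then obtain n where n: "n \<ge> K"
        "dist (z (r (Suc n))) zb + M * (\<zeta> (s n) + C * \<xi> (\<phi> (r (Suc n)) - L)) < \<delta>"
      unfolding eventually_sequentially by (metis nle_le)
    define p where "p = s n"
    have p: "p \<ge> K" "dist (z (Suc p)) zb + M * (\<zeta> p + C * \<xi> (\<phi> (Suc p) - L)) < \<delta>"
      using n s[of n] Suc_s[of n] by (simp_all add: p_def)

    have "summable (\<lambda>k. \<zeta> (k + p))"
    \<comment> \<open>The iterates run one index ahead of \<open>\<zeta>\<close>, because (B2)
      bounds \<open>w (Suc k)\<close> by \<open>\<zeta> k\<close>.\<close>
    proof (rule summable_of_captured[where x = "\<lambda>k. z (Suc (k + p))" and M = M and c = zb and \<delta> = \<delta>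
          and b = "\<lambda>k. C * \<xi> (\<phi> (Suc (k + p)) - L)"])
      fix k
      let ?j = "Suc (k + p)"
      have j: "ereal (\<phi> ?j - L) < \<eta>" "ereal (\<phi> (Suc ?j) - L) < \<eta>"
        using p(1) by (auto intro!: in_\<eta>)
      show "0 \<le> C * \<xi> (\<phi> ?j - L)"
        using \<xi> C j(1) L_le[of ?j] unfolding desingularizing_def Let_def by auto
      show "dist (z ?j) (z (Suc (Suc k + p))) \<le> M * \<zeta> (Suc k + p)"
        using step_le[of ?j] by (simp add: dist_norm)
      assume "z ?j \<in> ball zb \<delta>"
      then have "z ?j \<in> U" using \<delta> by blast
      then have "1 \<le> deriv \<xi> (\<phi> ?j - L) * norm (w ?j)"
        using j(1) L_less by (intro KL_inequality[OF \<open>proper \<Phi>\<close> \<xi> KL w zb \<phi>]) auto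
      also have "\<dots> \<le> deriv \<xi> (\<phi> ?j - L) * (\<rho>\<^sub>3 * \<zeta> (k + p))"
        using \<xi> j(1) L_less[of ?j] w_le[of "k + p"] unfolding desingularizing_def Let_def
        by (intro mult_left_mono) (auto intro: less_imp_le)
      finally have "1 \<le> deriv \<xi> (\<phi> ?j - L) * (\<rho>\<^sub>3 * \<zeta> (k + p))" .
      moreover have "deriv \<xi> (\<phi> ?j - L) * (\<phi> ?j - \<phi> (Suc ?j)) \<le>
          \<xi> (\<phi> ?j - L) - \<xi> (\<phi> (Suc ?j) - L)"
        using desingularizing_tangent[OF \<xi> _ j(2) _ j(1)] L_le[of "Suc ?j"] L_less[of ?j] by simp
      ultimately have "2 * \<zeta> ?j \<le> \<zeta> (k + p) + C * (\<xi> (\<phi> ?j - L) - \<xi> (\<phi> (Suc ?j) - L))"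
        unfolding C_def by (rule KL_descent_step[OF _ _ dec nonneg \<open>0 < \<rho>\<^sub>3\<close> \<open>0 < \<rho>\<^sub>2\<close>])
      then show "2 * \<zeta> (Suc k + p) \<le> \<zeta> (k + p) +
          (C * \<xi> (\<phi> ?j - L) - C * \<xi> (\<phi> (Suc (Suc k + p)) - L))"
        by (simp add: algebra_simps)
    qed (use nonneg M p(2) in auto)
    then show ?thesis by (rule summable_iff_shift[THEN iffD1])
  qed

  then have "summable (\<lambda>k. \<zeta> (Suc k))" by (rule summable_Suc_iff[THEN iffD2])
  moreover have "z \<longlonglongrightarrow> zb"
  proof -
    \<comment> \<open>Finite length makes the whole sequence converge; its limit is
      \<open>zb\<close> because a subsequence already tends there.\<close>
    have "convergent z"
      using summable_mult[OF \<open>summable \<zeta>\<close>] step_le by (rule convergent_of_summable_steps)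
    then obtain l where l: "z \<longlonglongrightarrow> l" by (auto simp: convergent_def)
    with LIMSEQ_unique[OF sub[OF l] r(2)] show ?thesis by simp
  qed
  ultimately show ?thesis using crit by blast
qed

end
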